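(* Let $N\ge 1$, $R>0$, $\Omega=B_R(0)=\{x\in\mathbb{R}^N:|x|<R\}$, $\sigma>0$, $\alpha\in(1,2]$, and put $p=\frac{\alpha}{\alpha-1}$ and $C_\alpha=\frac{\alpha-1}{\alpha^{\alpha/(\alpha-1)}}$. Let $h(x)=\tilde h(|x|)$ be radial, where $\tilde h:[0,\infty)\to[0,\infty)$ is continuous and the limit $\lim_{|x|\to\infty}\tilde h(|x|)/|x|^p$ exists and belongs to $(0,+\infty)$, and let $g\ge 0$ be a constant. Then the unique solution $V$ of the Dirichlet problem $$-\frac{\sigma^2}{2}\Delta V(x)+C_\alpha|\nabla V(x)|^p-h(x)=0\quad\text{for } x\in B_R(0),\qquad V=g\quad\text{on }\partial B_R(0),$$ is radial: $V(x)=u(|x|)$ for some function $u:[0,R]\to\mathbb{R}$ satisfying the ordinary differential equation $$-\frac{\sigma^2}{2}\Big(u''(r)+\frac{N-1}{r}u'(r)\Big)+C_\alpha|u'(r)|^p-\tilde h(r)=0,\qquad 0<r<R,$$ with boundary conditions $u'(0)=0$ and $u(R)=g$.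
   Context: $|\cdot|$ denotes the Euclidean norm on $\mathbb{R}^N$. A solution of the Dirichlet problem means a classical solution $V\in C^2(\Omega)\cap C^{1,\beta}(\overline{\Omega})$ for some $\beta\in(0,1)$, where $C^{1,\beta}(\overline{\Omega})$ is the usual space of functions that are $C^1$ up to the boundary with $\beta$-Hölder continuous first derivatives. *)

theory Defs
  imports "HOL-Analysis.Analysis"
begin

definition partial_deriv :: "'n::finite \<Rightarrow> (real^'n \<Rightarrow> real) \<Rightarrow> real^'n \<Rightarrow> real"
  where "partial_deriv i f x = deriv (\<lambda>t. f (x + t *\<^sub>R axis i 1)) 0"

definition grad :: "(real^'n \<Rightarrow> real) \<Rightarrow> real^'n \<Rightarrow> real^'n"
  where "grad f x = (\<chi> i. partial_deriv i f x)"

definition laplacian :: "(real^'n \<Rightarrow> real) \<Rightarrow> real^'n \<Rightarrow> real"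
  where "laplacian f x = (\<Sum>i\<in>UNIV. partial_deriv i (partial_deriv i f) x)"

(* C^1 and C^2 are meant for open S only: partial_deriv looks at the values of f
   in a full neighbourhood of the point. *)

definition C1_on :: "(real^'n) set \<Rightarrow> (real^'n \<Rightarrow> real) \<Rightarrow> bool"
  where "C1_on S f \<longleftrightarrow>
    (\<forall>x\<in>S. f differentiable (at x)) \<and> (\<forall>i. continuous_on S (partial_deriv i f))"

definition C2_on :: "(real^'n) set \<Rightarrow> (real^'n \<Rightarrow> real) \<Rightarrow> bool"
  where "C2_on S f \<longleftrightarrow> C1_on S f \<and> (\<forall>i. C1_on S (partial_deriv i f))"

(* The space C^{1,b}(closure S) for a bounded open set S: f is C^1 in S, continuous on
   closure S, and its gradient extends to closure S as a b-Hoelder continuous map G.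
   Values of f outside closure S play no role. *)

definition C1_holder_closure :: "(real^'n) set \<Rightarrow> real \<Rightarrow> (real^'n \<Rightarrow> real) \<Rightarrow> bool"
  where "C1_holder_closure S b f \<longleftrightarrow>
    C1_on S f \<and> continuous_on (closure S) f \<and>
    (\<exists>G K. (\<forall>x\<in>S. G x = grad f x) \<and>
      (\<forall>x\<in>closure S. \<forall>y\<in>closure S. norm (G x - G y) \<le> K * norm (x - y) powr b))"

definition classical_solution ::
    "real \<Rightarrow> real \<Rightarrow> real \<Rightarrow> (real^'n \<Rightarrow> real) \<Rightarrow> real \<Rightarrow> real \<Rightarrow> (real^'n \<Rightarrow> real) \<Rightarrow> bool"
  where "classical_solution \<sigma> p C h g R V \<longleftrightarrow>
    C2_on (ball 0 R) V \<and>
    (\<exists>b. 0 < b \<and> b < 1 \<and> C1_holder_closure (ball 0 R) b V) \<and>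
    (\<forall>x\<in>ball 0 R. - (\<sigma>\<^sup>2 / 2) * laplacian V x + C * norm (grad V x) powr p - h x = 0) \<and>
    (\<forall>x\<in>frontier (ball 0 R). V x = g)"

(* u is viewed as a function on [0, R] only, so its derivative at 0 is one-sided;
   u' and u'' are the first and second derivatives of u, and N is the dimension. *)

definition radial_ode_solution ::
    "nat \<Rightarrow> real \<Rightarrow> real \<Rightarrow> real \<Rightarrow> (real \<Rightarrow> real) \<Rightarrow> real \<Rightarrow> real \<Rightarrow> (real \<Rightarrow> real) \<Rightarrow> bool"
  where "radial_ode_solution N \<sigma> p C k g R u \<longleftrightarrow>
    (\<exists>u' u''.
      (\<forall>r\<in>{0..<R}. (u has_real_derivative u' r) (at r within {0..R})) \<and>
      (\<forall>r\<in>{0<..<R}. (u' has_real_derivative u'' r) (at r) \<and>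
        - (\<sigma>\<^sup>2 / 2) * (u'' r + (real N - 1) / r * u' r) + C * \<bar>u' r\<bar> powr p - k r = 0) \<and>
      u' 0 = 0 \<and> u R = g)"

end

(* With v = - u' the radial equation becomes (r^(N-1) v)' = r^(N-1) F, F = (2/sigma^2) (h - C v^p),
   that is v(r) = r * int_0^1 t^(N-1) F(r t) dt.  In this form the singularity at r = 0 has
   disappeared.  After truncating v to an a priori bound the right-hand side is Lipschitz in v and
   Banach's fixed point theorem in an exponentially weighted supremum norm gives a solution; it obeys
   0 <= v <= R * max (2/sigma^2) h, so the truncation is inactive.  A primitive u of -v with u(R) = g
   then yields the classical solution V(x) = u(|x|); at the origin C^2 holds because
   v(r)/r tends to F(0)/N.  Uniqueness is the weak maximum principle: gradients of classical
   solutions are bounded, so |.|^p is Lipschitz along them, and W - V + eps * exp(mu * x_k) has no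
   interior maximum when mu is large. *)
theory Submission
  imports Defs
begin

section \<open>The integrated equation for the flux v = - u', and regularity of the average
  v(r)/r\<close>

section \<open>The radial flux equation\<close>

text \<open>The factor 1/2 comes from \<open>\<mu> = 2 * K\<close>: integrating r K d exp(\<mu> r t)
  over t in [0,1] gives (K/\<mu>) d (exp(\<mu> r) - 1), at most (d/2) exp(\<mu> r), and the weight
  exp(- \<mu> r) cancels the growth. This is the contraction estimate for the integral operator,
  with \<open>d\<close> the weighted distance of two candidates.\<close>

lemma weighted_integral_bound:
  fixes K \<mu> r d :: real
  assumes "K > 0" "r \<ge> 0" "\<mu> = 2 * K" "d \<ge> 0"
    and f: "continuous_on {0..1} f"
    and b: "\<And>t. t \<in> {0..1} \<Longrightarrow> \<bar>f t\<bar> \<le> K * (exp (\<mu> * (r * t)) * d)"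
  shows "\<bar>exp (- \<mu> * r) * (r * integral {0..1} f)\<bar> \<le> d / 2"
proof -
  have \<mu>: "\<mu> > 0" using assms by simp
  have "((\<lambda>t. K * d / \<mu> * exp (\<mu> * (r * t))) has_vector_derivative r * (K * (exp (\<mu> * (r * t)) * d)))
      (at t within {0..1})" for t
    unfolding has_real_derivative_iff_has_vector_derivative[symmetric]
    using \<mu> by (auto intro!: derivative_eq_intros simp: field_simps)
  from fundamental_theorem_of_calculus[OF _ this]
  have I: "((\<lambda>t. r * (K * (exp (\<mu> * (r * t)) * d))) has_integral K * d / \<mu> * (exp (\<mu> * r) - 1)) {0..1}"
    by (simp add: algebra_simps)
  have "norm (integral {0..1} (\<lambda>t. r * f t)) \<le> integral {0..1} (\<lambda>t. r * (K * (exp (\<mu> * (r * t)) * d)))"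
  proof (rule integral_norm_bound_integral)
    show "(\<lambda>t. r * f t) integrable_on {0..1}"
      by (intro integrable_continuous_interval continuous_intros f)
    show "(\<lambda>t. r * (K * (exp (\<mu> * (r * t)) * d))) integrable_on {0..1}"
      using I by (rule has_integral_integrable)
    show "norm (r * f t) \<le> r * (K * (exp (\<mu> * (r * t)) * d))" if "t \<in> {0..1}" for t
      using b[OF that] \<open>r \<ge> 0\<close> by (simp add: abs_mult mult_left_mono)
  qed
  then have "\<bar>r * integral {0..1} f\<bar> \<le> K * d / \<mu> * (exp (\<mu> * r) - 1)"
    using integral_unique[OF I] by simp
  also have "\<dots> \<le> d / 2 * exp (\<mu> * r)"
    using assms by (simp add: field_simps)
  finally have "exp (- \<mu> * r) * \<bar>r * integral {0..1} f\<bar> \<le> exp (- \<mu> * r) * (d / 2 * exp (\<mu> * r))"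
    by (intro mult_left_mono) auto
  also have "\<dots> = d / 2" by (simp add: exp_minus field_simps)
  finally show ?thesis by (simp add: abs_mult)
qed

text \<open>The fixed point is sought for y(r) = exp(- \<mu> r) v(r), so that the plain supremum
  metric on y is the weighted one on v. By \<open>weighted_integral_bound\<close> the operator then
  contracts on all of [0,R] at once, whatever the size of R and K.\<close>

lemma singular_volterra_exists:
  fixes f :: "real \<Rightarrow> real \<Rightarrow> real"
  assumes "R > 0" "K > 0"
    and f: "continuous_on UNIV (\<lambda>z. f (fst z) (snd z))"
    and lip: "\<And>s x y. \<bar>f s x - f s y\<bar> \<le> K * \<bar>x - y\<bar>"
  shows "\<exists>v. continuous_on UNIV v \<and>
    (\<forall>r\<in>{0..R}. v r = r * integral {0..1} (\<lambda>t. t ^ n * f (r * t) (v (r * t))))"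
proof -
  define \<mu> where "\<mu> = 2 * K"
  \<comment> \<open>Bounded continuous functions on the whole line form a complete metric type.
    Clamping the argument to [0,R] extends a continuous function on [0,R] to an element of that
    type.\<close>
  define cl where "cl r = max 0 (min R r)" for r :: real
  define j where "j y r t = t ^ n * f (r * t) (exp (\<mu> * (r * t)) * apply_bcontfun y (r * t))"
    for y :: "real \<Rightarrow>\<^sub>C real" and r t
  define Q where "Q y r = exp (- \<mu> * r) * (r * integral {0..1} (j y r))" for y r
  have y [continuous_intros]: "continuous_on A (\<lambda>x. apply_bcontfun y (g x))"
    if "continuous_on A g" for A :: "'b::topological_space set" and g and y :: "real \<Rightarrow>\<^sub>C real"
    using continuous_on_compose2[OF continuous_on_apply_bcontfun that] by auto
  have fc [continuous_intros]: "continuous_on A (\<lambda>x. f (g x) (k x))"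
    if "continuous_on A g" "continuous_on A k" for A :: "'b::topological_space set" and g k
    using continuous_on_compose2[OF f continuous_on_Pair[OF that]] by simp
  have cl [continuous_intros]: "continuous_on A (\<lambda>x. cl (g x))"
    if "continuous_on A g" for A :: "'b::topological_space set" and g
    unfolding cl_def by (intro continuous_intros that)
  have clr: "cl r \<in> {0..R}" for r using \<open>R > 0\<close> by (auto simp: cl_def)
  have j [continuous_intros]: "continuous_on A (j y r)" for A y r
    unfolding j_def by (intro continuous_intros)
  have Q: "continuous_on {0..R} (Q y)" for y
  proof -
    have "continuous_on {0..R} (\<lambda>r. integral (cbox 0 1) (j y r))"
      unfolding j_def
      by (rule integral_continuous_on_param) (auto simp: split_def intro!: continuous_intros)
    then show ?thesis unfolding Q_def by (auto intro!: continuous_intros)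
  qed
  define T where "T y = Bcontfun (\<lambda>r. Q y (cl r))" for y
  have "(\<lambda>r. Q y (cl r)) \<in> bcontfun" for y
  proof -
    have "continuous_on UNIV (\<lambda>r. Q y (cl r))"
      using clr by (intro continuous_on_compose2[OF Q] continuous_intros) auto
    moreover have "bounded (Q y ` {0..R})"
      by (intro compact_imp_bounded compact_continuous_image Q) auto
    moreover have "range (\<lambda>r. Q y (cl r)) \<subseteq> Q y ` {0..R}" using clr by blast
    ultimately show ?thesis unfolding bcontfun_def using bounded_subset by blast
  qed
  then have T: "apply_bcontfun (T y) r = Q y (cl r)" for y r
    by (simp add: T_def Bcontfun_inverse)
  have contr: "dist (T y) (T z) \<le> 1 / 2 * dist y z" for y z
  proof (rule dist_bound)
    fix s
    define r where "r = cl s"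
    have r: "r \<in> {0..R}" using clr r_def by simp
    have "Q y r - Q z r = exp (- \<mu> * r) * (r * integral {0..1} (\<lambda>t. j y r t - j z r t))"
      unfolding Q_def
      by (subst Henstock_Kurzweil_Integration.integral_diff)
        (auto intro!: integrable_continuous_interval j simp: algebra_simps)
    also have "\<bar>\<dots>\<bar> \<le> dist y z / 2"
    proof (rule weighted_integral_bound[of K])
      show "continuous_on {0..1} (\<lambda>t. j y r t - j z r t)" by (intro continuous_intros)
      fix t :: real assume t: "t \<in> {0..1}"
      have "\<bar>j y r t - j z r t\<bar> = t ^ n * \<bar>f (r * t) (exp (\<mu> * (r * t)) * y (r * t)) - f (r * t) (exp (\<mu> * (r * t)) * z (r * t))\<bar>"
        using t by (simp add: j_def flip: right_diff_distrib abs_mult) (simp add: abs_mult)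
      also have "\<dots> \<le> 1 * (K * \<bar>exp (\<mu> * (r * t)) * y (r * t) - exp (\<mu> * (r * t)) * z (r * t)\<bar>)"
        using t by (intro mult_mono lip) (auto simp: power_le_one)
      also have "\<dots> = K * (exp (\<mu> * (r * t)) * dist (y (r * t)) (z (r * t)))"
        by (simp add: dist_real_def abs_mult flip: right_diff_distrib)
      also have "\<dots> \<le> K * (exp (\<mu> * (r * t)) * dist y z)"
        using \<open>K > 0\<close> by (intro mult_left_mono dist_bounded) auto
      finally show "\<bar>j y r t - j z r t\<bar> \<le> K * (exp (\<mu> * (r * t)) * dist y z)" .
    qed (use \<open>K > 0\<close> r in \<open>auto simp: \<mu>_def\<close>)
    finally show "dist (T y s) (T z s) \<le> 1 / 2 * dist y z"
      by (simp add: T dist_real_def r_def)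
  qed
  obtain y where "T y = y"
    using banach_fix_type[of "1/2" T] contr by auto
  then have fp: "y r = Q y (cl r)" for r using T by metis
  define v where "v r = exp (\<mu> * r) * y r" for r
  have "v r = r * integral {0..1} (\<lambda>t. t ^ n * f (r * t) (v (r * t)))" if "r \<in> {0..R}" for r
  proof -
    have "cl r = r" using that by (auto simp: cl_def)
    then have "v r = exp (\<mu> * r) * (exp (- \<mu> * r) * (r * integral {0..1} (j y r)))"
      using fp[of r] by (simp add: v_def Q_def)
    also have "\<dots> = r * integral {0..1} (j y r)"
      by (simp add: exp_minus field_simps)
    finally show ?thesis by (simp add: j_def[abs_def] v_def)
  qed
  moreover have "continuous_on UNIV v"
    unfolding v_def by (intro continuous_intros)
  ultimately show ?thesis by blast
qed

text \<open>Substitution s = r t, with G the primitive of s^n F(s) that vanishes at 0. It translates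
  the averaged form of the equation into the divergence form (r^n v)' = r^n F, which can be
  differentiated although F is only continuous.\<close>

lemma averaged_integral_eq:
  fixes F :: "real \<Rightarrow> real"
  assumes "continuous_on {0..R} F"
  shows "\<exists>G.
    (\<forall>r\<in>{0..R}. (G has_real_derivative r ^ n * F r) (at r within {0..R})) \<and>
    (\<forall>r\<in>{0..R}. G r = r ^ Suc n * integral {0..1} (\<lambda>t. t ^ n * F (r * t)))"
proof -
  have "continuous_on {0..R} (\<lambda>r. r ^ n * F r)" by (intro continuous_intros assms)
  from antiderivative_continuous[OF this]
  obtain G0 where G0: "\<And>x. x \<in> {0..R} \<Longrightarrow> (G0 has_vector_derivative x ^ n * F x) (at x within {0..R})"
    by blast
  define G where "G x = G0 x - G0 0" for x
  have G: "(G has_real_derivative x ^ n * F x) (at x within {0..R})" if "x \<in> {0..R}" for x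
    unfolding G_def has_real_derivative_iff_has_vector_derivative
    using G0[OF that] by (auto intro!: derivative_eq_intros)
  have "G r = r ^ Suc n * integral {0..1} (\<lambda>t. t ^ n * F (r * t))" if r: "r \<in> {0..R}" for r
  proof -
    have sub: "(\<lambda>t. r * t) ` {0..1} \<subseteq> {0..R}"
      using r by (auto intro: order_trans[OF mult_left_le])
    have "((\<lambda>t. G (r * t)) has_vector_derivative r ^ Suc n * (t ^ n * F (r * t))) (at t within {0..1})"
      if t: "t \<in> {0..1}" for t
    proof -
      have "(G has_real_derivative (r * t) ^ n * F (r * t)) (at (r * t) within (\<lambda>t. r * t) ` {0..1})"
        using G sub t by (intro DERIV_subset[OF G sub]) blast
      moreover have "((\<lambda>t. r * t) has_real_derivative r) (at t within {0..1})"
        by (auto intro!: derivative_eq_intros)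
      ultimately show ?thesis
        unfolding has_real_derivative_iff_has_vector_derivative[symmetric]
        by (rule DERIV_image_chain[THEN DERIV_cong, unfolded o_def]) (simp add: power_mult_distrib)
    qed
    from fundamental_theorem_of_calculus[OF _ this]
    have "((\<lambda>t. r ^ Suc n * (t ^ n * F (r * t))) has_integral G r) {0..1}"
      by (simp add: G_def)
    from integral_unique[OF this] show ?thesis by simp
  qed
  with G show ?thesis by (intro exI[of _ G]) (auto simp: G_def)
qed

text \<open>Mean value theorem: since p \<ge> 1, the derivative p z^(p-1) is at most its value at M.
  It serves twice, for the truncated flux and for the gradient norms of two solutions.\<close>

lemma powr_diff_le:
  fixes x y M p :: real
  assumes "p \<ge> 1" "x \<in> {0..M}" "y \<in> {0..M}"
  shows "\<bar>x powr p - y powr p\<bar> \<le> p * M powr (p - 1) * \<bar>x - y\<bar>"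
proof -
  have "\<bar>y powr p - x powr p\<bar> \<le> p * M powr (p - 1) * \<bar>y - x\<bar>" if xy: "x < y" "x \<in> {0..M}" "y \<in> {0..M}" for x y
  proof -
    have "\<exists>l z. x < z \<and> z < y \<and> ((\<lambda>x. x powr p) has_real_derivative l) (at z) \<and> y powr p - x powr p = (y - x) * l"
    proof (rule MVT[OF \<open>x < y\<close>])
      show "continuous_on {x..y} (\<lambda>x. x powr p)"
        using xy assms by (intro continuous_on_powr' continuous_intros) auto
      show "(\<lambda>x. x powr p) differentiable at z" if "x < z" "z < y" for z
        using has_real_derivative_powr[of z p] that xy by (auto simp: real_differentiable_def)
    qed
    then obtain l z where z: "x < z" "z < y" "((\<lambda>x. x powr p) has_real_derivative l) (at z)"
      "y powr p - x powr p = (y - x) * l" by blast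
    have "l = p * z powr (p - 1)"
      using DERIV_unique[OF z(3) has_real_derivative_powr] z xy by auto
    moreover have "z powr (p - 1) \<le> M powr (p - 1)"
      using z xy assms by (intro powr_mono2) auto
    ultimately show ?thesis using z assms xy by (simp add: abs_mult mult.commute mult_right_mono)
  qed
  from this[of x y] this[of y x] assms show ?thesis
    by (cases x y rule: linorder_cases) (auto simp: abs_minus_commute)
qed

text \<open>The power is not globally Lipschitz, so it is first composed with a clamp to [0,M]. The
  solution of the truncated equation is then shown to take values in [0,M], where the clamp is the
  identity.\<close>

lemma radial_flux_exists:
  fixes k :: "real \<Rightarrow> real"
  assumes "R > 0" "c \<ge> 0" "p \<ge> 1" and k: "continuous_on {0..R} k" and k0: "\<And>r. r \<in> {0..R} \<Longrightarrow> k r \<ge> 0"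
  obtains v where "continuous_on {0..R} v" "\<And>r. r \<in> {0..R} \<Longrightarrow> v r \<ge> 0"
    "\<And>r. r \<in> {0..R} \<Longrightarrow> v r = r * integral {0..1} (\<lambda>t. t ^ n * (k (r * t) - c * v (r * t) powr p))"
proof -
  define cl where "cl L x = max 0 (min L x)" for L x :: real
  have cl [continuous_intros]: "continuous_on A (\<lambda>x. cl L (g x))"
    if "continuous_on A g" for A :: "'b::topological_space set" and g L
    unfolding cl_def by (intro continuous_intros that)
  obtain H where H: "\<And>r. r \<in> {0..R} \<Longrightarrow> k r \<le> H" "H > 0"
  proof -
    have "bounded (k ` {0..R})" by (intro compact_imp_bounded compact_continuous_image k) auto
    then obtain B where "\<And>r. r \<in> {0..R} \<Longrightarrow> norm (k r) \<le> B" unfolding bounded_iff by blast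
    then show ?thesis by (intro that[of "\<bar>B\<bar> + 1"]) fastforce+
  qed
  \<comment> \<open>The absorption term only lowers v, so a solution should satisfy v(r) \<le> r H
    \<le> R H; this expected bound is the truncation level.\<close>
  define M where "M = R * H"
  have M: "M > 0" using \<open>R > 0\<close> H by (simp add: M_def)
  define f where "f s x = k (cl R s) - c * cl M x powr p" for s x
  \<comment> \<open>A Lipschitz constant of the truncated power; the added 1 keeps it positive even
    when c = 0.\<close>
  define K where "K = c * (p * M powr (p - 1)) + 1"
  have K: "K > 0" using assms by (simp add: K_def add_nonneg_pos)
  have lip: "\<bar>f s x - f s y\<bar> \<le> K * \<bar>x - y\<bar>" for s x y
  proof -
    have "\<bar>f s x - f s y\<bar> = c * \<bar>cl M x powr p - cl M y powr p\<bar>"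
    proof -
      have "f s x - f s y = c * (cl M y powr p - cl M x powr p)"
        by (simp add: f_def algebra_simps)
      then show ?thesis using \<open>c \<ge> 0\<close> by (simp add: abs_mult abs_minus_commute)
    qed
    also have "\<dots> \<le> c * (p * M powr (p - 1) * \<bar>cl M x - cl M y\<bar>)"
      using assms M by (intro mult_left_mono powr_diff_le) (auto simp: cl_def)
    also have "\<dots> \<le> c * (p * M powr (p - 1) * \<bar>x - y\<bar>)"
      using assms M by (intro mult_left_mono) (auto simp: cl_def)
    also have "\<dots> \<le> K * \<bar>x - y\<bar>" by (simp add: K_def algebra_simps)
    finally show ?thesis .
  qed
  have fc: "continuous_on A (\<lambda>x. f (g x) (m x))"
    if "continuous_on A g" "continuous_on A m" for A :: "'b::t2_space set" and g m
  proof -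
    have "continuous_on A (\<lambda>x. k (cl R (g x)))"
      using \<open>R > 0\<close> by (intro continuous_on_compose2[OF k] continuous_intros that) (auto simp: cl_def)
    then show ?thesis unfolding f_def
      using assms by (intro continuous_intros continuous_on_powr' that) (auto simp: cl_def)
  qed
  obtain v where v: "continuous_on UNIV v"
    and veq: "\<And>r. r \<in> {0..R} \<Longrightarrow> v r = r * integral {0..1} (\<lambda>t. t ^ n * f (r * t) (v (r * t)))"
    using singular_volterra_exists[OF \<open>R > 0\<close> K, of f n] lip
    by (auto simp: fc continuous_intros)
  define F where "F s = f s (v s)" for s
  have Fc: "continuous_on A F" for A
    unfolding F_def by (intro fc continuous_intros continuous_on_subset[OF v]) auto
  obtain G where G': "\<And>r. r \<in> {0..R} \<Longrightarrow> (G has_real_derivative r ^ n * F r) (at r within {0..R})"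
    and G: "\<And>r. r \<in> {0..R} \<Longrightarrow> G r = r ^ Suc n * integral {0..1} (\<lambda>t. t ^ n * F (r * t))"
    using averaged_integral_eq[OF Fc, of R n] by blast
  have Gv: "G r = r ^ n * v r" if "r \<in> {0..R}" for r
    using G[OF that] veq[OF that] by (simp add: F_def)
  \<comment> \<open>Wherever \<open>v < 0\<close> the absorption term is switched off, so \<open>r^n v\<close> is nondecreasing there.\<close>
  have v0: "v r \<ge> 0" if r: "r \<in> {0..R}" for r
  proof (rule ccontr)
    assume neg: "\<not> v r \<ge> 0"
    \<comment> \<open>The supremum r0 of \<open>A\<close> is the last point up to r with v \<ge> 0;
      it exists because v(0) = 0. On (r0, r] the function v is negative, so G = r^n v would have to
      fall from a nonnegative to a negative value there.\<close>
    define A where "A = {s \<in> {0..r}. v s \<ge> 0}"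
    have "A = {s \<in> {0..r}. 0 \<le> v s}" by (auto simp: A_def)
    moreover have "closed {s \<in> {0..r}. 0 \<le> v s}"
      by (intro continuous_on_closed_Collect_le continuous_intros continuous_on_subset[OF v]) auto
    ultimately have "closed A" by simp
    moreover have "0 \<in> A" using veq[of 0] \<open>R > 0\<close> r by (auto simp: A_def)
    moreover have bdd: "bdd_above A" by (auto simp: A_def)
    ultimately have "Sup A \<in> A" by (intro closed_contains_Sup) auto
    define r0 where "r0 = Sup A"
    have r0: "0 \<le> r0" "v r0 \<ge> 0" "r0 < r"
      using \<open>Sup A \<in> A\<close> neg by (auto simp: A_def r0_def order.order_iff_strict)
    have vneg: "v s < 0" if "r0 < s" "s \<le> r" for s
      using cSup_upper[OF _ bdd, of s] that r0 by (force simp: A_def r0_def)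
    have G'': "(G has_real_derivative s ^ n * F s) (at s)" if "r0 < s" "s < r" for s
      using G'[of s] at_within_Icc_at[of 0 s R] that r0 r by auto
    have "\<exists>l z. r0 < z \<and> z < r \<and> (G has_real_derivative l) (at z) \<and> G r - G r0 = (r - r0) * l"
    proof (rule MVT[OF \<open>r0 < r\<close>])
      show "continuous_on {r0..r} G"
        using r0 r by (intro continuous_on_subset[OF DERIV_continuous_on[OF G']]) auto
    qed (use G'' in \<open>auto simp: real_differentiable_def\<close>)
    then obtain l z where z: "r0 < z" "z < r" "(G has_real_derivative l) (at z)" "G r - G r0 = (r - r0) * l"
      by blast
    have "l = z ^ n * F z" using DERIV_unique[OF z(3) G''[OF z(1,2)]] .
    \<comment> \<open>A negative argument is clamped to 0, and \<open>0 powr p = 0\<close>.\<close>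
    moreover have "F z = k z"
      using vneg[of z] z r0 r M by (auto simp: F_def f_def cl_def min_def)
    ultimately have "(r - r0) * l \<ge> 0" using k0[of z] z r0 r by simp
    then have "G r \<ge> G r0" using z(4) by linarith
    moreover have "G r0 \<ge> 0" using Gv[of r0] r0 r by simp
    moreover have "G r < 0" using Gv[OF r] neg r0 by (simp add: mult_pos_neg)
    ultimately show False by simp
  qed
  have vM: "v r \<le> M" if r: "r \<in> {0..R}" for r
  proof -
    have "integral {0..1} (\<lambda>t. t ^ n * F (r * t)) \<le> integral {0..1} (\<lambda>t::real. H)"
    proof (rule integral_le)
      show "(\<lambda>t. t ^ n * F (r * t)) integrable_on {0..1}"
        by (intro integrable_continuous_interval continuous_intros continuous_on_compose2[OF Fc[of UNIV]]) auto
      fix t :: real assume t: "t \<in> {0..1}"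
      have "c * cl M (v (r * t)) powr p \<ge> 0" using \<open>c \<ge> 0\<close> by simp
      moreover have "k (cl R (r * t)) \<le> H" using \<open>R > 0\<close> by (intro H) (auto simp: cl_def)
      ultimately have "F (r * t) \<le> H" by (simp add: F_def f_def)
      then have "t ^ n * F (r * t) \<le> t ^ n * H" using t by (intro mult_left_mono) auto
      also have "\<dots> \<le> H" using t H by (intro mult_left_le_one_le) (auto simp: power_le_one)
      finally show "t ^ n * F (r * t) \<le> H" .
    qed auto
    then have "v r \<le> r * H" using veq[OF r] r by (simp add: F_def mult_left_mono)
    also have "\<dots> \<le> M" using r H by (simp add: M_def)
    finally show ?thesis .
  qed
  show ?thesis
  proof (rule that[of v])
    fix r assume r: "r \<in> {0..R}"
    have "f (r * t) (v (r * t)) = k (r * t) - c * v (r * t) powr p" if "t \<in> {0..1}" for t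
    proof -
      have "r * t \<in> {0..R}" using r that by (auto intro: order_trans[OF mult_left_le])
      then show ?thesis using v0[of "r * t"] vM[of "r * t"] by (simp add: f_def cl_def)
    qed
    then have "integral {0..1} (\<lambda>t. t ^ n * f (r * t) (v (r * t))) =
        integral {0..1} (\<lambda>t. t ^ n * (k (r * t) - c * v (r * t) powr p))"
      by (intro Henstock_Kurzweil_Integration.integral_cong) auto
    then show "v r = r * integral {0..1} (\<lambda>t. t ^ n * (k (r * t) - c * v (r * t) powr p))"
      using veq[OF r] by simp
  qed (use v0 continuous_on_subset[OF v] in auto)
qed

text \<open>Here \<open>\<phi>\<close> is the regular representative of v(r)/r. Its value at 0 comes
  from the integral of t^n over [0,1], and its derivative from the quotient rule for G(r) / r^(n+1),
  so F need not be differentiated.\<close>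

lemma averaged_integral_properties:
  fixes F \<phi> :: "real \<Rightarrow> real" and n :: nat
  defines "\<phi> \<equiv> \<lambda>r. integral {0..1} (\<lambda>t. t ^ n * F (r * t))"
  assumes F: "continuous_on {0..R} F"
  shows "continuous_on {0..R} \<phi>" and "\<phi> 0 = F 0 / Suc n"
    and "\<And>r. 0 < r \<Longrightarrow> r < R \<Longrightarrow> (\<phi> has_real_derivative (F r - Suc n * \<phi> r) / r) (at r)"
proof -
  have "continuous_on {0..R} (\<lambda>r. integral (cbox 0 1) (\<lambda>t. t ^ n * F (r * t)))"
  proof (rule integral_continuous_on_param)
    have "continuous_on ({0..R} \<times> {0..1}) (\<lambda>z. F (fst z * snd z))"
      by (intro continuous_on_compose2[OF F] continuous_intros) (auto intro: order_trans[OF mult_left_le])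
    then show "continuous_on ({0..R} \<times> cbox 0 1) (\<lambda>(r, t). t ^ n * F (r * t))"
      by (auto simp: split_def intro!: continuous_intros)
  qed
  then show "continuous_on {0..R} \<phi>" by (simp add: \<phi>_def)
  have "((\<lambda>t. t ^ Suc n / Suc n) has_vector_derivative t ^ n) (at t within {0..1})" for t :: real
    unfolding has_real_derivative_iff_has_vector_derivative[symmetric]
    by (auto intro!: derivative_eq_intros simp del: power_Suc of_nat_Suc)
  from fundamental_theorem_of_calculus[OF _ this]
  have "((\<lambda>t::real. t ^ n) has_integral 1 / Suc n) {0..1}" by simp
  from integral_unique[OF this] show "\<phi> 0 = F 0 / Suc n" by (simp add: \<phi>_def)
  obtain G where G': "\<And>r. r \<in> {0..R} \<Longrightarrow> (G has_real_derivative r ^ n * F r) (at r within {0..R})"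
    and G: "\<And>r. r \<in> {0..R} \<Longrightarrow> G r = r ^ Suc n * \<phi> r"
    unfolding \<phi>_def using averaged_integral_eq[OF F, of n] by blast
  fix r assume r: "0 < r" "r < R"
  have "(G has_real_derivative r ^ n * F r) (at r)"
    using G'[of r] at_within_Icc_at[of 0 r R] r by simp
  then have "((\<lambda>r. G r / r ^ Suc n) has_real_derivative
      (r ^ n * F r * r ^ Suc n - G r * (Suc n * r ^ n)) / (r ^ Suc n * r ^ Suc n)) (at r)"
    by (rule DERIV_divide) (use r in \<open>auto intro!: derivative_eq_intros simp del: power_Suc of_nat_Suc\<close>)
  also have "(r ^ n * F r * r ^ Suc n - G r * (Suc n * r ^ n)) / (r ^ Suc n * r ^ Suc n) = (F r - Suc n * \<phi> r) / r"
  proof -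
    have "r ^ n * F r * r ^ Suc n - G r * (Suc n * r ^ n) = (r ^ n * r ^ Suc n) * (F r - Suc n * \<phi> r)"
      using G[of r] r by (simp add: algebra_simps)
    then show ?thesis using r by (simp del: of_nat_Suc)
  qed
  finally show "(\<phi> has_real_derivative (F r - Suc n * \<phi> r) / r) (at r)"
  proof (rule has_field_derivative_transform_within_open)
    show "G z / z ^ Suc n = \<phi> z" if "z \<in> {0<..<R}" for z using G[of z] that by simp
  qed (use r in auto)
qed

section \<open>Gradient, Laplacian and regularity up to the boundary of x -> U(|x|)\<close>

section \<open>Radial functions\<close>

lemma partial_deriv_eq:
  assumes "(f has_derivative f') (at x)"
  shows "partial_deriv i f x = f' (axis i 1)"
proof -
  have "((\<lambda>t. x + t *\<^sub>R axis i 1) has_derivative (\<lambda>t. t *\<^sub>R axis i 1)) (at 0)"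
    by (auto intro!: derivative_eq_intros)
  then have "((\<lambda>t. f (x + t *\<^sub>R axis i 1)) has_derivative (\<lambda>t. f' (t *\<^sub>R axis i 1))) (at 0)"
    using assms by (auto intro!: has_derivative_compose[where f = "\<lambda>t. x + t *\<^sub>R axis i 1" and g = f])
  also have "(\<lambda>t. f' (t *\<^sub>R axis i 1)) = (\<lambda>t. f' (axis i 1) * t)"
    using has_derivative_linear[OF assms] by (simp add: linear_cmul mult.commute)
  finally have "((\<lambda>t. f (x + t *\<^sub>R axis i 1)) has_real_derivative f' (axis i 1)) (at 0)"
    by (simp add: has_field_derivative_def)
  then show ?thesis unfolding partial_deriv_def by (rule DERIV_imp_deriv)
qed

text \<open>Applied to the first partial derivatives of a radial function, this yields its Hessian.
  Away from 0 it is the product and chain rule. At 0, continuity of q makes (q(|y|) - q(0)) y_i of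
  order o(|y|), and the quotient in the formula is 0 there.\<close>

lemma radial_times_coord_has_derivative:
  fixes x :: "real^'n"
  assumes q: "continuous_on {0..R} q" and x: "x \<in> ball 0 R" and "d 0 = 0"
    and q': "\<And>r. 0 < r \<Longrightarrow> r < R \<Longrightarrow> (q has_real_derivative d r / r) (at r)"
  shows "((\<lambda>x. q (norm x) * x $ i) has_derivative
    (\<lambda>y. d (norm x) * (x \<bullet> y) * x $ i / (norm x)\<^sup>2 + q (norm x) * y $ i)) (at x)"
proof (cases "x = 0")
  case True
  have "R > 0" using x True by simp
  have "((\<lambda>y. q (norm y) - q 0) \<longlongrightarrow> 0) (at (0::real^'n))"
  proof -
    have "isCont (\<lambda>y::real^'n. q (norm y)) 0"
    proof -
      have "continuous_on (ball 0 R) (\<lambda>y::real^'n. q (norm y))"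
        by (intro continuous_on_compose2[OF q] continuous_intros) auto
      then show ?thesis using \<open>R > 0\<close> by (auto simp: continuous_on_eq_continuous_at)
    qed
    then show ?thesis using LIM_zero by (auto simp: isCont_def)
  qed
  then have "((\<lambda>y::real^'n. norm (q (norm y) - q 0)) \<longlongrightarrow> 0) (at 0)"
    by (rule tendsto_norm_zero)
  then have "((\<lambda>y::real^'n. norm ((q (norm y) - q 0) * y $ i) / norm y) \<longlongrightarrow> 0) (at 0)"
  proof (rule Lim_null_comparison[rotated])
    show "\<forall>\<^sub>F y in at (0::real^'n). norm (norm ((q (norm y) - q 0) * y $ i) / norm y) \<le> norm (q (norm y) - q 0)"
      by (rule always_eventually)
        (auto simp: abs_mult divide_le_eq component_le_norm_cart mult_left_mono)
  qed
  moreover have "bounded_linear (\<lambda>y::real^'n. q 0 * y $ i)"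
    by (intro bounded_linear_const_mult bounded_linear_vec_nth)
  ultimately show ?thesis
    using True by (simp add: has_derivative_at algebra_simps)
next
  case False
  have "((\<lambda>x. q (norm x)) has_derivative (\<lambda>y. (sgn x \<bullet> y) * (d (norm x) / norm x))) (at x)"
    using DERIV_compose_FDERIV[OF q' has_derivative_norm[OF False]] False x
    by (simp add: inner_commute)
  moreover have "((\<lambda>x. x $ i) has_derivative (\<lambda>y. y $ i)) (at x)"
    by (intro bounded_linear_imp_has_derivative bounded_linear_vec_nth)
  ultimately show ?thesis
    by (rule has_derivative_eq_rhs[OF has_derivative_mult])
      (simp add: fun_eq_iff sgn_div_norm power2_eq_square field_simps)
qed

text \<open>Away from 0 the factor r in U' cancels the |x| in the gradient x/|x| of the norm. At 0
  the same factor makes the one-sided derivative of U vanish, so U(|y|) - U(0) = o(|y|).\<close>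

lemma radial_has_derivative:
  fixes x :: "real^'n"
  assumes x: "x \<in> ball 0 R"
    and U: "\<And>r. r \<in> {0..R} \<Longrightarrow> (U has_real_derivative r * q r) (at r within {0..R})"
  shows "((\<lambda>x. U (norm x)) has_derivative (\<lambda>y. q (norm x) * (x \<bullet> y))) (at x)"
proof (cases "x = 0")
  case True
  have "R > 0" using x True by simp
  have "((\<lambda>r. (U r - U 0) / r) \<longlongrightarrow> 0) (at 0 within {0..R})"
    using U[of 0] \<open>R > 0\<close> by (simp add: has_field_derivative_iff)
  moreover have "filterlim (\<lambda>y::real^'n. norm y) (at 0 within {0..R}) (at 0)"
  proof (rule filterlim_at_withinI)
    show "filterlim (\<lambda>y::real^'n. norm y) (nhds 0) (at 0)"
      by (auto intro!: tendsto_eq_intros)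
    show "\<forall>\<^sub>F y in at (0::real^'n). norm y \<in> {0..R} - {0}"
      using \<open>R > 0\<close> by (auto simp: eventually_at intro!: exI[of _ R])
  qed
  ultimately have "((\<lambda>y::real^'n. (U (norm y) - U 0) / norm y) \<longlongrightarrow> 0) (at 0)"
    by (rule filterlim_compose)
  from tendsto_norm_zero[OF this] show ?thesis
    using True by (simp add: has_derivative_at)
next
  case False
  have "(U has_real_derivative norm x * q (norm x)) (at (norm x))"
    using U[of "norm x"] at_within_Icc_at[of 0 "norm x" R] x False by simp
  from DERIV_compose_FDERIV[OF this has_derivative_norm[OF False]] show ?thesis
    by (rule has_derivative_eq_rhs) (use False in \<open>simp add: fun_eq_iff sgn_div_norm inner_commute\<close>)
qed

text \<open>With r = |x| and s = |y|, the difference splits into ((r q(r) - s q(s)) / r) x, which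
  compares lengths, and q(s) ((s/r) x - y), which compares directions. The first is at most K |x -
  y|. In the second, |q(s)| \<le> K by taking one radius equal to 0 in the hypothesis, and the
  vector has norm at most 2 |x - y|.\<close>

lemma radial_field_lipschitz:
  fixes x y :: "'a::real_inner"
  assumes "norm x \<le> R" "norm y \<le> R"
    and lip: "\<And>r s. r \<in> {0..R} \<Longrightarrow> s \<in> {0..R} \<Longrightarrow> \<bar>r * q r - s * q s\<bar> \<le> K * \<bar>r - s\<bar>"
  shows "norm (q (norm x) *\<^sub>R x - q (norm y) *\<^sub>R y) \<le> 3 * K * norm (x - y)"
proof (cases "x = 0 \<or> y = 0")
  case True
  have "0 \<le> K * norm (z)" if "norm z \<le> R" for z :: 'a
    using order_trans[OF abs_ge_zero lip[of "norm z" 0]] that order_trans[OF norm_ge_zero that] by simp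
  then show ?thesis
    using True lip[of "norm x" 0] lip[of "norm y" 0] assms(1,2)
    by (auto simp: abs_mult mult.commute intro: order_trans)
next
  case False
  define r s where "r = norm x" and "s = norm y"
  have rs: "r > 0" "s > 0" "r \<le> R" "s \<le> R" using False assms by (auto simp: r_def s_def)
  have d: "\<bar>r - s\<bar> \<le> norm (x - y)" by (simp add: r_def s_def norm_triangle_ineq3)
  have K: "\<bar>q s\<bar> \<le> K" using lip[of s 0] rs by (simp add: abs_mult mult.commute)
  have "(s / r) *\<^sub>R x - y = (x - y) + ((s - r) / r) *\<^sub>R x"
    using rs by (simp add: diff_divide_distrib algebra_simps)
  then have "norm ((s / r) *\<^sub>R x - y) \<le> norm (x - y) + norm (((s - r) / r) *\<^sub>R x)"
    using norm_triangle_ineq by metis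
  also have "norm (((s - r) / r) *\<^sub>R x) = \<bar>r - s\<bar>" using rs by (simp add: r_def abs_minus_commute)
  finally have A: "norm ((s / r) *\<^sub>R x - y) \<le> 2 * norm (x - y)" using d by simp
  have "q r *\<^sub>R x - q s *\<^sub>R y = ((r * q r - s * q s) / r) *\<^sub>R x + q s *\<^sub>R ((s / r) *\<^sub>R x - y)"
    using rs by (simp add: diff_divide_distrib algebra_simps)
  then have "norm (q r *\<^sub>R x - q s *\<^sub>R y) \<le>
      norm (((r * q r - s * q s) / r) *\<^sub>R x) + norm (q s *\<^sub>R ((s / r) *\<^sub>R x - y))"
    using norm_triangle_ineq by metis
  also have "\<dots> = \<bar>r * q r - s * q s\<bar> + \<bar>q s\<bar> * norm ((s / r) *\<^sub>R x - y)"
    using rs by (simp add: r_def)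
  also have "\<dots> \<le> K * norm (x - y) + K * (2 * norm (x - y))"
    using K by (intro add_mono mult_mono A order_trans[OF lip] d mult_left_mono) (use rs in auto)
  finally show ?thesis by (simp add: r_def s_def)
qed

text \<open>Partial derivatives at a point of an open set depend only on nearby values. This permits
  replacing \<open>partial_deriv i V\<close> by an explicit formula, known only inside the ball,
  before differentiating again.\<close>

lemma C1_on_cong:
  assumes "open S" "\<And>x. x \<in> S \<Longrightarrow> f x = g x" "C1_on S g"
  shows "C1_on S f" and "\<And>x. x \<in> S \<Longrightarrow> partial_deriv i f x = partial_deriv i g x"
proof -
  have D: "(f has_derivative g') (at x)" if "(g has_derivative g') (at x)" "x \<in> S" for g' x
    using has_derivative_transform_within_open[OF that(1) assms(1) that(2)] assms(2) by metis
  have g: "g differentiable (at x)" if "x \<in> S" for x using assms(3) that by (auto simp: C1_on_def)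
  show P: "partial_deriv i f x = partial_deriv i g x" if x: "x \<in> S" for i x
  proof -
    obtain g' where "(g has_derivative g') (at x)" using g[OF x] by (auto simp: differentiable_def)
    then show ?thesis using partial_deriv_eq D x by metis
  qed
  have "f differentiable (at x)" if "x \<in> S" for x
    using g[OF that] D that by (auto simp: differentiable_def)
  moreover have "continuous_on S (partial_deriv i f)" for i
    using assms(3) P by (auto simp: C1_on_def cong: continuous_on_cong)
  ultimately show "C1_on S f" by (simp add: C1_on_def)
qed

text \<open>The Hessian entries are d(|x|) x_i x_j / |x|^2 + q(|x|) \<delta>_ij, and their trace is
  the Laplacian. The gradient field is Lipschitz on the closed ball, hence Hoelder there with any
  exponent below 1; the choice 1/2 is arbitrary.\<close>

proposition radial_classical:
  fixes U q d :: "real \<Rightarrow> real"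
  defines "V \<equiv> (\<lambda>x::real^'n. U (norm x))"
  assumes "R > 0" and q: "continuous_on {0..R} q" and d: "continuous_on {0..R} d" and "d 0 = 0"
    and U: "\<And>r. r \<in> {0..R} \<Longrightarrow> (U has_real_derivative r * q r) (at r within {0..R})"
    and q': "\<And>r. 0 < r \<Longrightarrow> r < R \<Longrightarrow> (q has_real_derivative d r / r) (at r)"
  shows "C2_on (ball 0 R) V" and "C1_holder_closure (ball 0 R) (1/2) V"
    and "\<And>x. x \<in> ball 0 R \<Longrightarrow> grad V x = q (norm x) *\<^sub>R x"
    and "\<And>x. x \<in> ball 0 R \<Longrightarrow> laplacian V x = d (norm x) + CARD('n) * q (norm x)"
proof -
  let ?B = "ball 0 R :: (real^'n) set"
  have V: "(V has_derivative (\<lambda>y. q (norm x) * (x \<bullet> y))) (at x)" if "x \<in> ?B" for x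
    unfolding V_def using radial_has_derivative[OF that U] .
  have p1: "partial_deriv i V x = q (norm x) * x $ i" if "x \<in> ?B" for x i
    using partial_deriv_eq[OF V[OF that]] by (simp add: inner_axis)
  define P where "P i x = q (norm x) * x $ i" for i and x :: "real^'n"
  have P: "(P i has_derivative (\<lambda>y. d (norm x) * (x \<bullet> y) * x $ i / (norm x)\<^sup>2 + q (norm x) * y $ i)) (at x)"
    if "x \<in> ?B" for x i
    unfolding P_def by (rule radial_times_coord_has_derivative[where d = d, OF q that \<open>d 0 = 0\<close> q'])
  have p2: "partial_deriv j (P i) x = d (norm x) * x $ j * x $ i / (norm x)\<^sup>2 + q (norm x) * axis j 1 $ i"
    if "x \<in> ?B" for x i j
    using partial_deriv_eq[OF P[OF that]] by (simp add: inner_axis)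
  have qn: "continuous_on ?B (\<lambda>x. q (norm x))" and dn: "continuous_on ?B (\<lambda>x. d (norm x))"
    by (auto intro!: continuous_on_compose2[OF q] continuous_on_compose2[OF d] continuous_intros)
  \<comment> \<open>Only the origin is delicate: there |x_i x_j| \<le> |x|^2 bounds the quotient by
    |d(|x|)|, which tends to d(0) = 0.\<close>
  have "isCont (\<lambda>x. d (norm x) * x $ j * x $ i / (norm x)\<^sup>2) x" if x: "x \<in> ?B" for x :: "real^'n" and i j
  proof (cases "x = 0")
    case True
    have "((\<lambda>x::real^'n. norm (d (norm x))) \<longlongrightarrow> 0) (at 0)"
    proof -
      have "isCont (\<lambda>x::real^'n. d (norm x)) 0"
        using dn \<open>R > 0\<close> by (auto simp: continuous_on_eq_continuous_at)
      then have "((\<lambda>x::real^'n. d (norm x)) \<longlongrightarrow> 0) (at 0)"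
        using \<open>d 0 = 0\<close> by (simp add: isCont_def)
      then show ?thesis by (rule tendsto_norm_zero)
    qed
    then have "((\<lambda>x. d (norm x) * x $ j * x $ i / (norm x)\<^sup>2) \<longlongrightarrow> 0) (at (0::real^'n))"
    proof (rule Lim_null_comparison[rotated], intro always_eventually allI)
      fix x :: "real^'n"
      have "\<bar>x $ j\<bar> * \<bar>x $ i\<bar> \<le> norm x * norm x"
        by (intro mult_mono component_le_norm_cart) auto
      then have "\<bar>d (norm x)\<bar> * (\<bar>x $ j\<bar> * \<bar>x $ i\<bar>) \<le> \<bar>d (norm x)\<bar> * (norm x * norm x)"
        by (rule mult_left_mono) simp
      then show "norm (d (norm x) * x $ j * x $ i / (norm x)\<^sup>2) \<le> norm (d (norm x))"
        by (cases "x = 0") (simp_all add: abs_mult divide_le_eq power2_eq_square mult.assoc)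
    qed
    then show ?thesis using True by (simp add: isCont_def)
  next
    case False
    have "isCont (\<lambda>x::real^'n. d (norm x)) x"
      using dn x by (auto simp: continuous_on_eq_continuous_at)
    then show ?thesis using False by (intro continuous_intros) auto
  qed
  then have "continuous_on ?B (\<lambda>x. d (norm x) * x $ j * x $ i / (norm x)\<^sup>2)" for i j
    by (simp add: continuous_on_eq_continuous_at)
  then have "continuous_on ?B (\<lambda>x. d (norm x) * x $ j * x $ i / (norm x)\<^sup>2 + q (norm x) * axis j 1 $ i)" for i j
    by (intro continuous_on_add continuous_on_mult qn continuous_on_const)
  then have cP: "continuous_on ?B (partial_deriv j (P i))" for i j
    by (rule continuous_on_eq) (use p2 in simp)
  have C1P: "C1_on ?B (P i)" for i
    using P cP unfolding C1_on_def differentiable_def by blast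
  have pP: "partial_deriv i V x = P i x" if "x \<in> ?B" for x i
    using p1[OF that] by (simp add: P_def)
  have C1: "C1_on ?B V"
  proof -
    have "continuous_on ?B (P i)" for i
      unfolding P_def by (intro continuous_intros qn)
    then have "continuous_on ?B (partial_deriv i V)" for i
      by (rule continuous_on_eq) (use pP in simp)
    then show ?thesis using V unfolding C1_on_def differentiable_def by blast
  qed
  show "C2_on ?B V"
    unfolding C2_on_def using C1 C1_on_cong(1)[OF open_ball pP C1P] by blast
  show G: "grad V x = q (norm x) *\<^sub>R x" if "x \<in> ?B" for x
    using p1[OF that] by (simp add: grad_def vec_eq_iff)
  show "laplacian V x = d (norm x) + CARD('n) * q (norm x)" if x: "x \<in> ?B" for x
  proof -
    have "laplacian V x = (\<Sum>i\<in>UNIV. partial_deriv i (P i) x)"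
      unfolding laplacian_def using C1_on_cong(2)[OF open_ball pP C1P x] by simp
    also have "\<dots> = (\<Sum>i\<in>UNIV. d (norm x) / (norm x)\<^sup>2 * (x $ i)\<^sup>2 + q (norm x))"
      using p2[OF x] by (simp add: power2_eq_square mult.assoc)
    also have "\<dots> = d (norm x) / (norm x)\<^sup>2 * (\<Sum>i\<in>UNIV. (x $ i)\<^sup>2) + CARD('n) * q (norm x)"
      by (simp add: sum.distrib sum_distrib_left)
    also have "(\<Sum>i\<in>UNIV. (x $ i)\<^sup>2) = (norm x)\<^sup>2"
      by (simp add: norm_vec_def L2_set_def sum_nonneg)
    \<comment> \<open>At the origin division by zero makes the first term 0, in agreement with d(0)
      = 0.\<close>
    finally show ?thesis using \<open>d 0 = 0\<close> by (cases "x = 0") auto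
  qed
  have cU: "continuous_on {0..R} U" using U by (rule DERIV_continuous_on)
  \<comment> \<open>The derivative of r q(r) is q + d, because r (d/r) = d; it is bounded since q
    and d are continuous on [0,R].\<close>
  obtain K where K: "\<And>r s. r \<in> {0..R} \<Longrightarrow> s \<in> {0..R} \<Longrightarrow> \<bar>r * q r - s * q s\<bar> \<le> K * \<bar>r - s\<bar>" "K \<ge> 0"
  proof -
    have "bounded ((\<lambda>r. q r + d r) ` {0..R})"
      by (intro compact_imp_bounded compact_continuous_image continuous_intros q d) auto
    then obtain K where K: "\<And>r. r \<in> {0..R} \<Longrightarrow> \<bar>q r + d r\<bar> \<le> K"
      unfolding bounded_iff by fastforce
    have *: "\<bar>s * q s - r * q r\<bar> \<le> K * \<bar>s - r\<bar>" if "r < s" "r \<in> {0..R}" "s \<in> {0..R}" for r s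
    proof -
      have D: "((\<lambda>r. r * q r) has_real_derivative q z + d z) (at z)" if "r < z" "z < s" for z
        using q'[of z] that \<open>r \<in> _\<close> \<open>s \<in> _\<close> by (auto intro!: derivative_eq_intros)
      have "\<exists>l z. r < z \<and> z < s \<and> ((\<lambda>r. r * q r) has_real_derivative l) (at z) \<and>
          s * q s - r * q r = (s - r) * l"
        using that D
        by (intro MVT continuous_intros continuous_on_subset[OF q]) (auto simp: real_differentiable_def)
      then obtain l z where z: "r < z" "z < s" "((\<lambda>r. r * q r) has_real_derivative l) (at z)"
        "s * q s - r * q r = (s - r) * l" by blast
      have "l = q z + d z" using DERIV_unique[OF z(3) D[OF z(1,2)]] .
      then show ?thesis using K[of z] z that by (simp add: abs_mult mult.commute mult_right_mono)
    qed
    have "K \<ge> 0" using K[of 0] \<open>R > 0\<close> by simp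
    moreover have "\<bar>r * q r - s * q s\<bar> \<le> K * \<bar>r - s\<bar>" if "r \<in> {0..R}" "s \<in> {0..R}" for r s
      using *[of r s] *[of s r] that
      by (cases r s rule: linorder_cases) (auto simp: abs_minus_commute)
    ultimately show ?thesis using that by blast
  qed
  \<comment> \<open>Distances in the closed ball are at most 2R, so |x - y| \<le> (2R)^(1/2) |x -
    y|^(1/2) turns the Lipschitz bound into a Hoelder bound.\<close>
  have "norm (q (norm x) *\<^sub>R x - q (norm y) *\<^sub>R y) \<le> (3 * K * (2 * R) powr (1/2)) * norm (x - y) powr (1/2)"
    if "x \<in> closure ?B" "y \<in> closure ?B" for x y :: "real^'n"
  proof -
    have xy: "norm x \<le> R" "norm y \<le> R" using that \<open>R > 0\<close> by auto
    then have "norm (x - y) \<le> 2 * R" using norm_triangle_ineq4[of x y] by linarith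
    then have "norm (x - y) powr (1/2) \<le> (2 * R) powr (1/2)" by (intro powr_mono2) auto
    then have "norm (x - y) powr (1/2) * norm (x - y) powr (1/2) \<le> (2 * R) powr (1/2) * norm (x - y) powr (1/2)"
      by (rule mult_right_mono) simp
    also have "norm (x - y) powr (1/2) * norm (x - y) powr (1/2) = norm (x - y)"
      by (simp flip: powr_add)
    finally have "3 * K * norm (x - y) \<le> 3 * K * ((2 * R) powr (1/2) * norm (x - y) powr (1/2))"
      using \<open>K \<ge> 0\<close> by (intro mult_left_mono) auto
    then show ?thesis using radial_field_lipschitz[OF xy K(1)] by (simp add: mult.assoc)
  qed
  moreover have "continuous_on (closure ?B) V"
    unfolding V_def using \<open>R > 0\<close> by (intro continuous_on_compose2[OF cU] continuous_intros) auto
  ultimately show "C1_holder_closure ?B (1/2) V"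
    unfolding C1_holder_closure_def using C1 G
    by (intro conjI exI[of _ "\<lambda>x. q (norm x) *\<^sub>R x"] exI[of _ "3 * K * (2 * R) powr (1/2)"]) auto
qed

section \<open>A weak maximum principle for two solutions with the same data\<close>

section \<open>Comparison of classical solutions\<close>

text \<open>If l were positive, f' would be positive immediately to the right of its zero at 0, and
  the mean value theorem would give values of f above f(0).\<close>

lemma deriv2_nonpos_at_local_max:
  fixes f :: "real \<Rightarrow> real"
  assumes "e > 0" and max: "\<And>t. \<bar>t\<bar> < e \<Longrightarrow> f t \<le> f 0"
    and f': "\<And>t. \<bar>t\<bar> < e \<Longrightarrow> (f has_real_derivative f' t) (at t)"
    and l: "(f' has_real_derivative l) (at 0)"
  shows "f' 0 = 0" and "l \<le> 0"
proof -
  show f0: "f' 0 = 0"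
  proof (rule DERIV_local_max[OF f' \<open>e > 0\<close>])
    show "\<forall>y. \<bar>0 - y\<bar> < e \<longrightarrow> f y \<le> f 0" using max by simp
  qed (use \<open>e > 0\<close> in simp)
  show "l \<le> 0"
  proof (rule ccontr)
    assume "\<not> l \<le> 0"
    then obtain \<delta> where \<delta>: "\<delta> > 0" "\<And>h. 0 < h \<Longrightarrow> h < \<delta> \<Longrightarrow> 0 < f' h"
      using DERIV_pos_inc_right[OF l] f0 by auto
    define h where "h = min e \<delta> / 2"
    have h: "0 < h" "h < e" "h < \<delta>" using \<open>e > 0\<close> \<delta>(1) by (auto simp: h_def)
    have "\<exists>z. 0 < z \<and> z < h \<and> f h - f 0 = (h - 0) * f' z"
      using h by (intro MVT2 f') auto
    then obtain z where z: "0 < z" "z < h" "f h - f 0 = h * f' z" by auto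
    moreover have "h * f' z > 0" using \<delta>(2)[of z] h z by (intro mult_pos_pos) auto
    ultimately show False using max[of h] h by linarith
  qed
qed

lemma C1_on_line_derivative:
  assumes "C1_on S f" "x + t *\<^sub>R axis i 1 \<in> S"
  shows "((\<lambda>s. f (x + s *\<^sub>R axis i 1)) has_real_derivative partial_deriv i f (x + t *\<^sub>R axis i 1)) (at t)"
proof -
  obtain f' where f': "(f has_derivative f') (at (x + t *\<^sub>R axis i 1))"
    using assms by (auto simp: C1_on_def differentiable_def)
  have "((\<lambda>s. x + s *\<^sub>R axis i 1) has_derivative (\<lambda>s. s *\<^sub>R axis i 1)) (at t)"
    by (auto intro!: derivative_eq_intros)
  from has_derivative_compose[OF this f']
  have "((\<lambda>s. f (x + s *\<^sub>R axis i 1)) has_derivative (\<lambda>s. f' (s *\<^sub>R axis i 1))) (at t)" .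
  also have "(\<lambda>s. f' (s *\<^sub>R axis i 1)) = (\<lambda>s. f' (axis i 1) * s)"
    using has_derivative_linear[OF f'] by (simp add: linear_cmul mult.commute)
  finally show ?thesis
    using partial_deriv_eq[OF f'] by (simp add: has_field_derivative_def)
qed

text \<open>Compare the Hoelder extension of the gradient with its value at the centre, at distance
  less than R. The bound uses \<open>\<bar>K\<bar>\<close> since the definition does not fix the
  sign of \<open>K\<close>.\<close>

lemma C1_holder_closure_grad_bounded:
  fixes f :: "real^'n \<Rightarrow> real"
  assumes "R > 0" "b > 0" "C1_holder_closure (ball 0 R) b f"
  shows "\<exists>M. \<forall>x\<in>ball 0 R. norm (grad f x) \<le> M"
proof -
  obtain G K where G: "\<And>x. x \<in> ball 0 R \<Longrightarrow> G x = grad f x"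
    and K: "\<And>x y. x \<in> closure (ball 0 R) \<Longrightarrow> y \<in> closure (ball 0 R) \<Longrightarrow>
      norm (G x - G y) \<le> K * norm (x - y) powr b"
    using assms(3) unfolding C1_holder_closure_def by blast
  have "norm (grad f x) \<le> norm (G 0) + \<bar>K\<bar> * R powr b" if x: "x \<in> ball 0 R" for x
  proof -
    have "norm (G x) \<le> norm (G 0) + norm (G x - G 0)"
      using norm_triangle_ineq[of "G 0" "G x - G 0"] by simp
    also have "norm (G x - G 0) \<le> K * norm x powr b"
      using K[of x 0] x \<open>R > 0\<close> by simp
    also have "\<dots> \<le> \<bar>K\<bar> * R powr b"
      using x \<open>b > 0\<close> by (intro mult_mono powr_mono2) auto
    finally show ?thesis using G[OF x] by simp
  qed
  then show ?thesis by blast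
qed

text \<open>At an interior maximum of W - V itself the gradients agree and the Laplacians differ by
  a nonpositive amount, which is no contradiction. The added \<epsilon> exp(\<mu> z_k) makes it
  strict: with E its value at the maximum point, the gradients differ by \<mu> E in norm and the
  Laplacian of W - V is at most - \<mu>^2 E. The equations then force (\<sigma>^2/2) \<mu> \<le> B,
  against the choice of \<mu>.\<close>

lemma classical_solution_le:
  fixes V W :: "real^'n \<Rightarrow> real"
  assumes "R > 0" "\<sigma> > 0" "C \<ge> 0" "p \<ge> 1"
    and W: "classical_solution \<sigma> p C h g R W" and V: "classical_solution \<sigma> p C h g R V"
    and x: "x \<in> cball 0 R"
  shows "W x \<le> V x"
proof (rule ccontr)
  assume neg: "\<not> W x \<le> V x"
  let ?B = "ball 0 R :: (real^'n) set"
  have grad_bdd: "\<exists>M. \<forall>x\<in>?B. norm (grad f x) \<le> M" if f: "classical_solution \<sigma> p C h g R f" for f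
  proof -
    obtain b where "b > 0" "C1_holder_closure ?B b f"
      using f unfolding classical_solution_def by blast
    from C1_holder_closure_grad_bounded[OF \<open>R > 0\<close> this] show ?thesis .
  qed
  obtain M1 where M1: "\<forall>x\<in>?B. norm (grad W x) \<le> M1" using grad_bdd[OF W] by (rule exE)
  obtain M2 where M2: "\<forall>x\<in>?B. norm (grad V x) \<le> M2" using grad_bdd[OF V] by (rule exE)
  define M where "M = max M1 M2"
  have M: "norm (grad W x) \<in> {0..M}" "norm (grad V x) \<in> {0..M}" if "x \<in> ?B" for x
    using M1 M2 that by (simp_all add: M_def max.coboundedI1 max.coboundedI2)
  \<comment> \<open>\<open>B\<close> is a Lipschitz constant of s -> C s^p on [0,M], where both
    gradient norms lie; \<open>\<mu>\<close> is chosen so that (\<sigma>^2/2) \<mu> = B +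
    \<sigma>^2/2.\<close>
  define B where "B = C * (p * M powr (p - 1))"
  define \<mu> where "\<mu> = 2 * B / \<sigma>\<^sup>2 + 1"
  have "B \<ge> 0" using assms by (simp add: B_def)
  then have "\<mu> > 0" by (simp add: \<mu>_def add_nonneg_pos)
  moreover have "\<sigma>\<^sup>2 / 2 * \<mu> = B + \<sigma>\<^sup>2 / 2"
    using \<open>\<sigma> > 0\<close> by (simp add: \<mu>_def field_simps)
  ultimately have \<mu>: "\<mu> > 0" "\<sigma>\<^sup>2 / 2 * \<mu> > B" using \<open>\<sigma> > 0\<close> by simp_all
  \<comment> \<open>Any coordinate direction will do.\<close>
  obtain k :: 'n where True by blast
  \<comment> \<open>On the closed ball the exponential is at most exp(\<mu> R), so the perturbation
    stays below half the gap W x - V x. Boundary values of \<open>\<Phi>\<close> are therefore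
    smaller than \<open>\<Phi> x\<close>.\<close>
  define \<epsilon> where "\<epsilon> = (W x - V x) / (2 * exp (\<mu> * R))"
  have \<epsilon>: "\<epsilon> > 0" "\<epsilon> * exp (\<mu> * R) < W x - V x" using neg by (auto simp: \<epsilon>_def)
  define \<Phi> where "\<Phi> z = W z - V z + \<epsilon> * exp (\<mu> * z $ k)" for z
  have cont: "continuous_on (cball 0 R) f" if "classical_solution \<sigma> p C h g R f" for f
    using that \<open>R > 0\<close> unfolding classical_solution_def C1_holder_closure_def closure_ball[OF \<open>R > 0\<close>]
    by (elim conjE exE)
  have "continuous_on (cball 0 R) \<Phi>"
    unfolding \<Phi>_def by (intro continuous_intros cont W V)
  then have "\<exists>y\<in>cball 0 R. \<forall>z\<in>cball 0 R. \<Phi> z \<le> \<Phi> y"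
    using x by (intro continuous_attains_sup compact_cball) blast+
  then obtain y where y: "y \<in> cball 0 R" "\<And>z. z \<in> cball 0 R \<Longrightarrow> \<Phi> z \<le> \<Phi> y"
    by blast
  have "y \<in> ?B"
  proof (rule ccontr)
    assume "y \<notin> ?B"
    then have *: "y \<in> frontier ?B" "norm y = R" using y \<open>R > 0\<close> by auto
    then have "W y = V y" using W V by (simp add: classical_solution_def)
    then have "\<Phi> y = \<epsilon> * exp (\<mu> * y $ k)" by (simp add: \<Phi>_def)
    also have "\<dots> \<le> \<epsilon> * exp (\<mu> * R)"
      using component_le_norm_cart[of y k] * \<mu> \<epsilon> by simp
    also have "\<dots> < \<Phi> x" using \<epsilon> mult_pos_pos[OF \<epsilon>(1) exp_gt_zero[of "\<mu> * x $ k"]] unfolding \<Phi>_def by linarith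
    finally show False using y(2)[OF x] by simp
  qed
  define E where "E = \<epsilon> * exp (\<mu> * y $ k)"
  have "E > 0" using \<epsilon> by (simp add: E_def)
  have C2: "C1_on ?B W" "C1_on ?B V" "C1_on ?B (partial_deriv i W)" "C1_on ?B (partial_deriv i V)" for i
    using W V unfolding classical_solution_def C2_on_def by blast+
  obtain e where e: "e > 0" "ball y e \<subseteq> ?B" using \<open>y \<in> ?B\<close> open_ball[of 0 R] unfolding open_contains_ball by blast
  \<comment> \<open>First and second order conditions along each coordinate line through the maximum
    point; \<open>axis k 1 $ i\<close> is a Kronecker delta, since the exponential varies only in
    direction k.\<close>
  have D: "partial_deriv i W y - partial_deriv i V y + \<mu> * E * axis k 1 $ i = 0 \<and>
      partial_deriv i (partial_deriv i W) y - partial_deriv i (partial_deriv i V) y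
        + \<mu>\<^sup>2 * E * axis k 1 $ i \<le> 0" for i
  proof -
    define a where "a = axis k (1::real) $ i"
    \<comment> \<open>As \<open>a\<close> is 0 or 1, the a^2 produced by differentiating the
      exponential twice can be written as \<open>a\<close>.\<close>
    have a: "axis i (1::real) $ k = a" "a * (a * z) = a * z" for z by (auto simp: a_def axis_def)
    have L: "y + t *\<^sub>R axis i 1 \<in> ?B" if "\<bar>t\<bar> < e" for t
    proof -
      have "y + t *\<^sub>R axis i 1 \<in> ball y e" using that by (simp add: dist_norm)
      then show ?thesis using e(2) by blast
    qed
    define f where "f t = \<Phi> (y + t *\<^sub>R axis i 1)" for t
    define f' where "f' t = partial_deriv i W (y + t *\<^sub>R axis i 1) - partial_deriv i V (y + t *\<^sub>R axis i 1)
        + \<epsilon> * (\<mu> * a * exp (\<mu> * (y $ k + t * a)))" for t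
    have m: "f t \<le> f 0" if "\<bar>t\<bar> < e" for t
      using y(2)[of "y + t *\<^sub>R axis i 1"] L[OF that] by (simp add: f_def)
    have f': "(f has_real_derivative f' t) (at t)" if "\<bar>t\<bar> < e" for t
      unfolding f_def f'_def \<Phi>_def vector_add_component vector_scaleR_component a real_scaleR_def
      by (rule derivative_eq_intros C1_on_line_derivative[OF C2(1) L[OF that]]
          C1_on_line_derivative[OF C2(2) L[OF that]] refl)+ (simp add: a)
    have d2: "((\<lambda>s. partial_deriv i u (y + s *\<^sub>R axis i 1)) has_real_derivative
        partial_deriv i (partial_deriv i u) y) (at 0)" if "C1_on ?B (partial_deriv i u)" for u
      using C1_on_line_derivative[OF that L[of 0]] \<open>e > 0\<close> by simp
    have f'': "(f' has_real_derivative partial_deriv i (partial_deriv i W) y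
        - partial_deriv i (partial_deriv i V) y + \<mu>\<^sup>2 * E * a) (at 0)"
      unfolding f'_def
      by (rule derivative_eq_intros d2[OF C2(3)] d2[OF C2(4)] refl)+
        (simp add: E_def a power2_eq_square mult_ac)
    show ?thesis
      using deriv2_nonpos_at_local_max[OF \<open>e > 0\<close> m f' f'']
      by (simp add: f'_def E_def mult_ac flip: a_def)
  qed
  have "grad W y - grad V y = - (\<mu> * E) *\<^sub>R axis k 1"
    using D by (simp add: grad_def vec_eq_iff algebra_simps eq_neg_iff_add_eq_0)
  then have "norm (grad W y - grad V y) = \<mu> * E"
    using \<mu> \<open>E > 0\<close> by simp
  then have gdiff: "\<bar>norm (grad W y) - norm (grad V y)\<bar> \<le> \<mu> * E"
    using norm_triangle_ineq3 by metis
  have "(\<Sum>i\<in>UNIV. partial_deriv i (partial_deriv i W) y - partial_deriv i (partial_deriv i V) y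
        + \<mu>\<^sup>2 * E * axis k 1 $ i) \<le> 0"
    using D by (intro sum_nonpos) blast
  moreover have "(\<Sum>i\<in>UNIV. axis k (1::real) $ i) = 1" by (simp add: axis_def)
  ultimately have lap: "laplacian W y - laplacian V y \<le> - (\<mu>\<^sup>2 * E)"
    by (simp add: laplacian_def sum.distrib sum_subtractf flip: sum_distrib_left)
  have "\<bar>norm (grad W y) powr p - norm (grad V y) powr p\<bar> \<le> p * M powr (p - 1) * \<bar>norm (grad W y) - norm (grad V y)\<bar>"
    by (rule powr_diff_le[OF \<open>p \<ge> 1\<close> M(1) M(2)]) fact+
  also have "\<dots> \<le> p * M powr (p - 1) * (\<mu> * E)"
    using gdiff \<open>p \<ge> 1\<close> by (intro mult_left_mono) auto
  finally have "C * \<bar>norm (grad W y) powr p - norm (grad V y) powr p\<bar> \<le> B * (\<mu> * E)"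
    using \<open>C \<ge> 0\<close> by (simp add: B_def mult_left_mono mult.assoc)
  moreover have "- (C * (norm (grad W y) powr p - norm (grad V y) powr p)) \<le> C * \<bar>norm (grad W y) powr p - norm (grad V y) powr p\<bar>"
    unfolding mult_minus_right[symmetric] using \<open>C \<ge> 0\<close> by (intro mult_left_mono) auto
  moreover have "\<sigma>\<^sup>2 / 2 * (laplacian W y - laplacian V y) = C * (norm (grad W y) powr p - norm (grad V y) powr p)"
  proof -
    have "- (\<sigma>\<^sup>2 / 2) * laplacian f y + C * norm (grad f y) powr p - h y = 0"
      if "classical_solution \<sigma> p C h g R f" for f
      using that \<open>y \<in> ?B\<close> unfolding classical_solution_def by blast
    from this[OF W] this[OF V] show ?thesis unfolding right_diff_distrib by linarith
  qed
  moreover have "\<sigma>\<^sup>2 / 2 * (laplacian W y - laplacian V y) \<le> \<sigma>\<^sup>2 / 2 * (- (\<mu>\<^sup>2 * E))"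
    using lap by (rule mult_left_mono) simp
  moreover have "\<sigma>\<^sup>2 / 2 * (- (\<mu>\<^sup>2 * E)) = - (\<sigma>\<^sup>2 / 2 * \<mu> * (\<mu> * E))"
    by (simp add: power2_eq_square)
  ultimately have "\<sigma>\<^sup>2 / 2 * \<mu> * (\<mu> * E) \<le> B * (\<mu> * E)" by linarith
  then show False using \<mu> \<open>E > 0\<close> by (simp add: mult_le_cancel_right)
qed

section \<open>Construction of V from the flux and verification of both equations\<close>

section \<open>Existence, uniqueness and radial symmetry\<close>

theorem theorem1p2:
  fixes R \<sigma> \<alpha> p C L g :: real
    and h :: "real^'n \<Rightarrow> real"
    and h_rad :: "real \<Rightarrow> real"
  assumes "R > 0" and "\<sigma> > 0" and "1 < \<alpha>" and "\<alpha> \<le> 2"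
    and "p = \<alpha> / (\<alpha> - 1)"
    and "C = (\<alpha> - 1) / \<alpha> powr (\<alpha> / (\<alpha> - 1))"
    and "\<And>x. h x = h_rad (norm x)"
    and "continuous_on {0..} h_rad"
    and "\<And>r. r \<ge> 0 \<Longrightarrow> h_rad r \<ge> 0"
    and "((\<lambda>x::real^'n. h_rad (norm x) / norm x powr p) \<longlongrightarrow> L) at_infinity"
    and "L > 0"
    and "g \<ge> 0"
  shows "\<exists>V :: real^'n \<Rightarrow> real.
    classical_solution \<sigma> p C h g R V \<and>
    (\<forall>W. classical_solution \<sigma> p C h g R W \<longrightarrow> (\<forall>x\<in>cball 0 R. W x = V x)) \<and>
    (\<exists>u. (\<forall>x\<in>cball 0 R. V x = u (norm x)) \<and>
      radial_ode_solution CARD('n) \<sigma> p C h_rad g R u)"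
proof -
  have p: "p \<ge> 1" using \<open>1 < \<alpha>\<close> assms(5) by (simp add: le_divide_eq)
  have C: "C \<ge> 0" using \<open>1 < \<alpha>\<close> assms(6) by simp
  define a where "a = 2 / \<sigma>\<^sup>2"
  have a: "a > 0" "\<sigma>\<^sup>2 / 2 * a = 1" using \<open>\<sigma> > 0\<close> by (auto simp: a_def)
  \<comment> \<open>The exponent N - 1 of the radial volume element, so that the factor
    \<open>Suc n\<close> in the averaging lemma is the dimension.\<close>
  define n where "n = CARD('n) - 1"
  have N: "Suc n = CARD('n)" by (simp add: n_def)
  have k: "continuous_on {0..R} (\<lambda>r. a * h_rad r)"
    by (intro continuous_intros continuous_on_subset[OF assms(8)]) auto
  have k0: "a * h_rad r \<ge> 0" if "r \<in> {0..R}" for r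
    using a assms(9) that by simp
  obtain v where v: "continuous_on {0..R} v" and v0: "\<And>r. r \<in> {0..R} \<Longrightarrow> v r \<ge> 0"
    and veq: "\<And>r. r \<in> {0..R} \<Longrightarrow>
      v r = r * integral {0..1} (\<lambda>t. t ^ n * (a * h_rad (r * t) - a * C * v (r * t) powr p))"
    using radial_flux_exists[OF \<open>R > 0\<close> _ p k k0, where c = "a * C" and n = n] a C by auto
  define F where "F r = a * h_rad r - a * C * v r powr p" for r
  have F: "continuous_on {0..R} F"
    unfolding F_def using p v0
    by (intro continuous_intros continuous_on_powr' v k) auto
  define \<phi> where "\<phi> r = integral {0..1} (\<lambda>t. t ^ n * F (r * t))" for r
  note \<phi> = averaged_integral_properties[OF F, where n = n, folded \<phi>_def, unfolded N]
  have v_\<phi>: "v r = r * \<phi> r" if "r \<in> {0..R}" for r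
    using veq[OF that] by (simp add: \<phi>_def F_def)
  \<comment> \<open>With u' = - v these are q = u'/r and d = r q', both continuous up to r = 0;
    consequently u'' = (r q)' = q + d.\<close>
  define q where "q r = - \<phi> r" for r
  define d where "d r = CARD('n) * \<phi> r - F r" for r
  have q: "continuous_on {0..R} q" and d: "continuous_on {0..R} d"
    unfolding q_def d_def by (intro continuous_intros \<phi>(1) F)+
  have d0: "d 0 = 0" using \<phi>(2) by (simp add: d_def)
  have q': "(q has_real_derivative d r / r) (at r)" if "0 < r" "r < R" for r
    unfolding q_def d_def using DERIV_minus[OF \<phi>(3)[OF that]] by (simp add: minus_divide_left)
  have "continuous_on {0..R} (\<lambda>r. r * q r)" by (intro continuous_intros q)
  from antiderivative_continuous[OF this]
  obtain U0 where U0: "\<And>r. r \<in> {0..R} \<Longrightarrow> (U0 has_vector_derivative r * q r) (at r within {0..R})"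
    by blast
  \<comment> \<open>The constant of integration is fixed by the boundary value U(R) = g.\<close>
  define U where "U r = U0 r - U0 R + g" for r
  have U: "(U has_real_derivative r * q r) (at r within {0..R})" if "r \<in> {0..R}" for r
    unfolding U_def has_real_derivative_iff_has_vector_derivative
    using U0[OF that] by (auto intro!: derivative_eq_intros)
  define V where "V x = U (norm x)" for x :: "real^'n"
  have V: "C2_on (ball 0 R) V" "C1_holder_closure (ball 0 R) (1/2) V"
    "x \<in> ball 0 R \<Longrightarrow> grad V x = q (norm x) *\<^sub>R x"
    "x \<in> ball 0 R \<Longrightarrow> laplacian V x = d (norm x) + CARD('n) * q (norm x)" for x
    unfolding V_def by (rule radial_classical[OF \<open>R > 0\<close> q d d0 U q'], assumption+)+
  \<comment> \<open>Nonnegativity of v enters here: it identifies |u'|^p with the v^p of the flux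
    equation.\<close>
  have flux: "\<bar>r * q r\<bar> = v r" if "r \<in> {0..R}" for r
    using v_\<phi>[OF that] v0[OF that] by (simp add: q_def)
  have F_eq: "\<sigma>\<^sup>2 / 2 * F r = h_rad r - C * v r powr p" for r
  proof -
    have "\<sigma>\<^sup>2 / 2 * F r = (\<sigma>\<^sup>2 / 2 * a) * (h_rad r - C * v r powr p)"
      by (simp add: F_def algebra_simps)
    then show ?thesis unfolding a(2) by simp
  qed
  have sol: "classical_solution \<sigma> p C h g R V"
    unfolding classical_solution_def
  proof (intro conjI ballI exI[of _ "1/2"] V(1,2))
    fix x :: "real^'n"
    {
      assume x: "x \<in> ball 0 R"
      have "norm (grad V x) = v (norm x)"
        using V(3)[OF x] flux[of "norm x"] x by (simp add: abs_mult mult.commute)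
      \<comment> \<open>The averages cancel: d + N q = (N \<phi> - F) - N \<phi>.\<close>
      moreover have "laplacian V x = - F (norm x)"
        using V(4)[OF x] by (simp add: d_def q_def)
      ultimately show "- (\<sigma>\<^sup>2 / 2) * laplacian V x + C * norm (grad V x) powr p - h x = 0"
        using F_eq[of "norm x"] assms(7)[of x] by (simp add: diff_divide_distrib)
    next
      assume "x \<in> frontier (ball 0 R)"
      then show "V x = g" using \<open>R > 0\<close> by (simp add: V_def U_def)
    }
  qed auto
  moreover have "W x = V x" if "classical_solution \<sigma> p C h g R W" "x \<in> cball 0 R" for W x
    using classical_solution_le[OF \<open>R > 0\<close> \<open>\<sigma> > 0\<close> C p that(1) sol that(2)]
      classical_solution_le[OF \<open>R > 0\<close> \<open>\<sigma> > 0\<close> C p sol that(1) that(2)] by (rule antisym)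
  moreover have "radial_ode_solution CARD('n) \<sigma> p C h_rad g R U"
    unfolding radial_ode_solution_def
  \<comment> \<open>The witnesses are u' = r q and u'' = q + d; the factor r gives u'(0) =
    0.\<close>
  proof (rule exI[of _ "\<lambda>r. r * q r"], rule exI[of _ "\<lambda>r. q r + d r"], intro conjI ballI)
    fix r assume r: "r \<in> {0<..<R}"
    show "((\<lambda>r. r * q r) has_real_derivative q r + d r) (at r)"
      using q'[of r] r by (auto intro!: derivative_eq_intros)
    have "(real CARD('n) - 1) / r * (r * q r) = (real CARD('n) - 1) * q r" using r by simp
    then have "q r + d r + (real CARD('n) - 1) / r * (r * q r) = - F r"
      by (simp add: q_def d_def algebra_simps)
    then show "- (\<sigma>\<^sup>2 / 2) * (q r + d r + (real CARD('n) - 1) / r * (r * q r))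
        + C * \<bar>r * q r\<bar> powr p - h_rad r = 0"
      using F_eq[of r] flux[of r] r by (simp add: diff_divide_distrib)
  next
    fix r assume "r \<in> {0..<R}"
    then show "(U has_real_derivative r * q r) (at r within {0..R})" by (intro U) simp
  qed (simp_all add: U_def)
  moreover have "\<forall>x\<in>cball 0 R. V x = U (norm x)" by (simp add: V_def)
  ultimately show ?thesis by blast
qed

end
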